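(* Let $V$ and $A$ be arbitrary sets and $a,b$ two distinct elements of $A$. Let $\mathcal P=\mathcal S(A)^V$ be the strict universal domain, and let $\chi:\mathcal P\to 2^V$ be defined by $\chi(P)=D(a,P)$. Then the set of all weakly group strategy-proof social choice functions $\phi:\mathcal P\to\{a,b\}$ consists of all and only the functions $P\mapsto\phi_{(\chi,C)}(P)$, where $C$ is a family of subsets of $V$ closed under supersets.
   Context: $V$ is the set of agents and $A$ the set of alternatives. $\mathcal W(A)$ is the set of all complete, transitive binary relations (preferences) on $A$, and $\mathcal S(A)$ is the subset of those that are also antisymmetric (strict preferences). For $W\in\mathcal W(A)$: $x\succ_W y$ means $(x,y)\in W$ and $(y,x)\notin W$. A profile in $\mathcal P=\mathcal S(A)^V$ is a function $P=(P_v)_{v\in V}$ from $V$ to $\mathcal S(A)$. $D(a,P)=\{v\in V: a\succ_{P_v}b\}$. A social choice function $\phi:\mathcal P\to A$ is weakly group strategy-proof if there are no nonempty $D\subseteq V$ and $P,Q\in\mathcal P$ such that $P_v=Q_v$ for all $v\in V\setminus D$ and $\phi(Q)\succ_{P_v}\phi(P)$ for all $v\in D$. The function $\phi_{(\chi,C)}:\mathcal P\to\{a,b\}$ is defined by $\phi_{(\chi,C)}(P)=a\iff\chi(P)\in C$. A family $C\subseteq 2^V$ is closed under supersets if $S\in C$, $S\subseteq T\subseteq V$ imply $T\in C$ (the empty family and $2^V$ are allowed). *)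

theory Defs
  imports Main "HOL-Library.FuncSet"
begin

definition complete_on :: "'a set \<Rightarrow> 'a rel \<Rightarrow> bool" where
  "complete_on A W \<longleftrightarrow> (\<forall>x\<in>A. \<forall>y\<in>A. (x, y) \<in> W \<or> (y, x) \<in> W)"

definition weak_prefs :: "'a set \<Rightarrow> 'a rel set" where
  "weak_prefs A = {W. W \<subseteq> A \<times> A \<and> complete_on A W \<and> trans W}"

definition strict_prefs :: "'a set \<Rightarrow> 'a rel set" where
  "strict_prefs A = {W \<in> weak_prefs A. antisym W}"

definition prefers :: "'a rel \<Rightarrow> 'a \<Rightarrow> 'a \<Rightarrow> bool" where
  "prefers W x y \<longleftrightarrow> (x, y) \<in> W \<and> (y, x) \<notin> W"

text \<open>Functions defined on a set are represented by extensional functions, so that equality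
  of HOL functions is equality on that set. This applies to profiles (defined on \<open>V\<close>)
  and to social choice functions (defined on profiles).\<close>

definition strict_profiles :: "'v set \<Rightarrow> 'a set \<Rightarrow> ('v \<Rightarrow> 'a rel) set" where
  "strict_profiles V A = V \<rightarrow>\<^sub>E strict_prefs A"

definition weakly_group_strategy_proof ::
  "'v set \<Rightarrow> ('v \<Rightarrow> 'a rel) set \<Rightarrow> (('v \<Rightarrow> 'a rel) \<Rightarrow> 'a) \<Rightarrow> bool" where
  "weakly_group_strategy_proof V \<P> \<phi> \<longleftrightarrow>
     \<not> (\<exists>D P Q. D \<noteq> {} \<and> D \<subseteq> V \<and> P \<in> \<P> \<and> Q \<in> \<P> \<and>
          (\<forall>v\<in>V - D. P v = Q v) \<and> (\<forall>v\<in>D. prefers (P v) (\<phi> Q) (\<phi> P)))"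

text \<open>The set \<open>D(a, P)\<close>; the second alternative \<open>b\<close>, implicit in that notation,
  is an explicit argument here.\<close>

definition supporters :: "'v set \<Rightarrow> 'a \<Rightarrow> 'a \<Rightarrow> ('v \<Rightarrow> 'a rel) \<Rightarrow> 'v set" where
  "supporters V a b P = {v \<in> V. prefers (P v) a b}"

definition phi ::
  "('v \<Rightarrow> 'a rel) set \<Rightarrow> 'a \<Rightarrow> 'a \<Rightarrow> (('v \<Rightarrow> 'a rel) \<Rightarrow> 'v set) \<Rightarrow> 'v set set
     \<Rightarrow> ('v \<Rightarrow> 'a rel) \<Rightarrow> 'a" where
  "phi \<P> a b \<chi> C = (\<lambda>P\<in>\<P>. if \<chi> P \<in> C then a else b)"

definition closed_under_supersets :: "'v set \<Rightarrow> 'v set set \<Rightarrow> bool" where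
  "closed_under_supersets V C \<longleftrightarrow> (\<forall>S T. S \<in> C \<and> S \<subseteq> T \<and> T \<subseteq> V \<longrightarrow> T \<in> C)"

end

(* Let P and Q be profiles with D(a,P) contained in D(a,Q), and let R agree with Q on D(a,Q) and
   with P elsewhere. If phi(P) = a, then phi(R) = a, since otherwise the coalition D(a,Q), whose
   members prefer a at R, would move from R to P; and then phi(Q) = a, since otherwise the
   coalition V - D(a,Q), whose members prefer b at R, would move from R to Q. So phi(P) depends
   only, and monotonically, on D(a,P). *)
theory Submission
  imports Defs
begin

lemma prefers_strict_prefs_total:
  assumes "W \<in> strict_prefs A" "x \<in> A" "y \<in> A" "x \<noteq> y"
  shows "prefers W x y \<or> prefers W y x"
  using assms
  unfolding strict_prefs_def weak_prefs_def complete_on_def prefers_def antisym_def by blast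

lemma weakly_group_strategy_proof_monotone:
  assumes ab: "a \<in> A" "b \<in> A" "a \<noteq> b"
    and phi: "\<phi> \<in> strict_profiles V A \<rightarrow> {a, b}"
    and wgsp: "weakly_group_strategy_proof V (strict_profiles V A) \<phi>"
    and P: "P \<in> strict_profiles V A" and Q: "Q \<in> strict_profiles V A"
    and sub: "supporters V a b P \<subseteq> supporters V a b Q"
    and Pa: "\<phi> P = a"
  shows "\<phi> Q = a"
proof (rule ccontr)
  assume "\<phi> Q \<noteq> a"
  with phi Q have Qb: "\<phi> Q = b" by blast
  let ?S = "supporters V a b Q"
  \<comment> \<open>Outside \<open>V\<close> the value is that of \<open>P\<close>, namely
    \<open>undefined\<close>, which keeps \<open>R\<close> extensional.\<close>
  define R where "R = (\<lambda>v. if v \<in> ?S then Q v else P v)"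
  have R: "R \<in> strict_profiles V A"
    using P Q unfolding R_def strict_profiles_def
    by (auto simp: PiE_iff extensional_def)
  \<comment> \<open>The requirement that outcomes differ replaces nonemptiness of the coalition: if
    \<open>D\<close> is empty, extensionality gives \<open>P' = Q'\<close>. This covers the extreme
    cases where \<open>?S\<close> or its complement in \<open>V\<close> is empty.\<close>
  have no_manipulation: False
    if "D \<subseteq> V" "P' \<in> strict_profiles V A" "Q' \<in> strict_profiles V A" "\<phi> Q' \<noteq> \<phi> P'"
      "\<forall>v\<in>V - D. P' v = Q' v" "\<forall>v\<in>D. prefers (P' v) (\<phi> Q') (\<phi> P')" for D P' Q'
  proof (cases "D = {}")
    case True
    with that have "P' = Q'"
      unfolding strict_profiles_def by (metis Diff_empty PiE_ext)
    with that show False by simp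
  next
    case False
    with wgsp that show False
      unfolding weakly_group_strategy_proof_def by blast
  qed
  show False
  proof (cases "\<phi> R = a")
    case True
    \<comment> \<open>Outside \<open>?S\<close> the profile \<open>R\<close> is \<open>P\<close>; by
      \<open>sub\<close> such a voter does not support \<open>a\<close> at \<open>P\<close>, and
      strictness then forces \<open>b\<close> above \<open>a\<close>.\<close>
    have "prefers (R v) b a" if "v \<in> V - ?S" for v
    proof -
      have "P v \<in> strict_prefs A"
        using P that unfolding strict_profiles_def by blast
      moreover have "\<not> prefers (P v) a b"
        using sub that unfolding supporters_def by blast
      ultimately show ?thesis
        using prefers_strict_prefs_total[of "P v" A a b] ab that by (simp add: R_def)
    qed
    then show False
      using no_manipulation[of "V - ?S" R Q] R Q True Qb ab by (simp add: R_def)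
  next
    case False
    with phi R have "\<phi> R = b" by blast
    moreover have "?S \<subseteq> V" "\<forall>v\<in>?S. prefers (R v) a b"
      by (auto simp: supporters_def R_def)
    ultimately show False
      using no_manipulation[of ?S R P] R P Pa ab by (simp add: R_def)
  qed
qed

text \<open>A coalition that gains by changing the outcome to \<open>a\<close> consists of
  supporters of \<open>a\<close>, so its move can only shrink their set; one that gains by changing
  it to \<open>b\<close> contains none of them, so its move can only enlarge the set. Superset
  closure makes the outcome respond in the opposite direction.\<close>

lemma weakly_group_strategy_proof_phi:
  assumes "a \<noteq> b" and C: "closed_under_supersets V C"
  shows "weakly_group_strategy_proof V \<P> (phi \<P> a b (supporters V a b) C)"
  unfolding weakly_group_strategy_proof_def
proof clarify
  let ?\<phi> = "phi \<P> a b (supporters V a b) C"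
  fix D P Q
  assume "D \<noteq> {}" and "D \<subseteq> V" and PQ: "P \<in> \<P>" "Q \<in> \<P>"
    and eq: "\<forall>v\<in>V - D. P v = Q v"
    and pref: "\<forall>v\<in>D. prefers (P v) (?\<phi> Q) (?\<phi> P)"
  let ?SP = "supporters V a b P" and ?SQ = "supporters V a b Q"
  have sub: "?SP \<subseteq> V" "?SQ \<subseteq> V"
    by (auto simp: supporters_def)
  \<comment> \<open>\<open>prefers\<close> is irreflexive, so any single member of \<open>D\<close>
    witnesses this.\<close>
  have "?\<phi> Q \<noteq> ?\<phi> P"
    using \<open>D \<noteq> {}\<close> pref unfolding prefers_def by auto
  then consider "?SQ \<in> C" "?SP \<notin> C" | "?SQ \<notin> C" "?SP \<in> C"
    using PQ by (auto simp: phi_def split: if_splits)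
  then show False
  proof cases
    case 1
    then have "\<forall>v\<in>D. prefers (P v) a b"
      using pref PQ by (simp add: phi_def)
    \<comment> \<open>Voters outside \<open>D\<close> have the same preference at both profiles, and
      all of \<open>D\<close> lies in \<open>?SP\<close>.\<close>
    then have "?SQ \<subseteq> ?SP"
      using eq unfolding supporters_def by auto
    then show False
      using 1 C sub unfolding closed_under_supersets_def by blast
  next
    case 2
    then have "\<forall>v\<in>D. prefers (P v) b a"
      using pref PQ by (simp add: phi_def)
    \<comment> \<open>By asymmetry of \<open>prefers\<close>, \<open>D\<close> is disjoint from
      \<open>?SP\<close>, so each voter in \<open>?SP\<close> keeps the same preference at
      \<open>Q\<close>.\<close>
    then have "?SP \<subseteq> ?SQ"
      using eq unfolding supporters_def prefers_def by auto
    then show False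
      using 2 C sub unfolding closed_under_supersets_def by blast
  qed
qed

theorem corollary5p1:
  fixes V :: "'v set" and A :: "'a set" and a b :: 'a
  assumes "a \<in> A" and "b \<in> A" and "a \<noteq> b"
  shows "{\<phi> \<in> strict_profiles V A \<rightarrow>\<^sub>E {a, b}.
            weakly_group_strategy_proof V (strict_profiles V A) \<phi>}
       = {phi (strict_profiles V A) a b (supporters V a b) C |
            C. C \<subseteq> Pow V \<and> closed_under_supersets V C}"
proof (intro equalityI subsetI)
  fix \<phi>
  assume "\<phi> \<in> {\<phi> \<in> strict_profiles V A \<rightarrow>\<^sub>E {a, b}.
            weakly_group_strategy_proof V (strict_profiles V A) \<phi>}"
  then have phi: "\<phi> \<in> strict_profiles V A \<rightarrow>\<^sub>E {a, b}"
    and wgsp: "weakly_group_strategy_proof V (strict_profiles V A) \<phi>"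
    by auto
  \<comment> \<open>This is the upward closure in \<open>V\<close> of the supporter sets of profiles
    with outcome \<open>a\<close>. Closure under supersets is thus built in, and no profile with a
    prescribed supporter set has to be constructed.\<close>
  define C where "C = {S. S \<subseteq> V \<and>
    (\<exists>P\<in>strict_profiles V A. supporters V a b P \<subseteq> S \<and> \<phi> P = a)}"
  have "\<phi> P = a \<longleftrightarrow> supporters V a b P \<in> C" if P: "P \<in> strict_profiles V A" for P
  proof
    assume "\<phi> P = a"
    then show "supporters V a b P \<in> C"
      using P by (auto simp: C_def supporters_def)
  next
    assume "supporters V a b P \<in> C"
    \<comment> \<open>Membership in \<open>C\<close> provides a profile with outcome
      \<open>a\<close> whose supporters all support \<open>a\<close> at \<open>P\<close> too;
      monotonicity carries the outcome over to \<open>P\<close>.\<close>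
    then show "\<phi> P = a"
      using weakly_group_strategy_proof_monotone[OF assms _ wgsp _ P] phi
      unfolding C_def by blast
  qed
  moreover have "\<phi> P \<in> {a, b}" if "P \<in> strict_profiles V A" for P
    using phi that by blast
  \<comment> \<open>Off the domain both functions take the default value, so they agree as HOL
    functions.\<close>
  moreover have "\<phi> P = undefined" if "P \<notin> strict_profiles V A" for P
    using phi that by (rule PiE_arb)
  ultimately have "\<phi> = phi (strict_profiles V A) a b (supporters V a b) C"
    by (fastforce simp: phi_def restrict_def)
  moreover have "C \<subseteq> Pow V" "closed_under_supersets V C"
    unfolding C_def closed_under_supersets_def by blast+
  ultimately show "\<phi> \<in> {phi (strict_profiles V A) a b (supporters V a b) C |
            C. C \<subseteq> Pow V \<and> closed_under_supersets V C}"
    by blast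
next
  fix \<phi>
  assume "\<phi> \<in> {phi (strict_profiles V A) a b (supporters V a b) C |
            C. C \<subseteq> Pow V \<and> closed_under_supersets V C}"
  then obtain C where C: "closed_under_supersets V C"
    and eq: "\<phi> = phi (strict_profiles V A) a b (supporters V a b) C"
    by blast
  have "\<phi> \<in> strict_profiles V A \<rightarrow>\<^sub>E {a, b}"
    unfolding eq phi_def by auto
  then show "\<phi> \<in> {\<phi> \<in> strict_profiles V A \<rightarrow>\<^sub>E {a, b}.
            weakly_group_strategy_proof V (strict_profiles V A) \<phi>}"
    using weakly_group_strategy_proof_phi[OF \<open>a \<noteq> b\<close> C] eq by simp
qed

end
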